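(* The Hess case in the Suslov problem (with a gravitational field) is equivalent to the Hess case in the Euler--Poisson equations.
   Context: "Equivalent" means that the equations of motion of the Suslov problem in its Hess case are isomorphic, up to a change of parameters, to the Euler--Poisson equations in the Hess case considered on the invariant Hess relation: a change of phase variables together with a change of parameters brings both to the same system. Hess case in the Suslov problem. A heavy rigid body with a fixed point is subject to the nonholonomic constraint $\omega_3=0$ on its angular velocity $\boldsymbol\omega$ (in body-fixed axes $Ox_1x_2x_3$ chosen so that the inertia tensor $\mathbf I=(I_{ij})$ has $I_{12}=0$); $\boldsymbol\gamma=(\gamma_1,\gamma_2,\gamma_3)$ is the unit vector of the vertical in these axes, $\boldsymbol\gamma^2=1$, and the potential energy is $(\boldsymbol b,\boldsymbol\gamma)$, where $\boldsymbol b=(b_1,b_2,b_3)=-mg\boldsymbol r$ and $\boldsymbol r$ is the radius vector of the center of mass. The equations of motion are $$I_{11}\dot\omega_1=-\omega_2(I_{13}\omega_1+I_{23}\omega_2)+b_3\gamma_2-b_2\gamma_3,\quad I_{22}\dot\omega_2=\omega_1(I_{13}\omega_1+I_{23}\omega_2)+b_1\gamma_3-b_3\gamma_1,$$ $$\dot\gamma_1=-\gamma_3\omega_2,\quad \dot\gamma_2=\gamma_3\omega_1,\quad \dot\gamma_3=\gamma_1\omega_2-\gamma_2\omega_1 .$$ All principal moments of inertia are assumed to be different. The Hess case is given by the conditions $$I_{13}=0,\quad I_{11}I_{22}=I_{22}^2+I_{23}^2,\quad b_1=0,\quad I_{22}b_2+I_{23}b_3=0,$$ under which the system has the additional integral $(\mathbf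 I\boldsymbol\omega,\boldsymbol\gamma)$. Hess case in the Euler--Poisson equations. The Euler--Poisson equations are $$\dot{\boldsymbol M}=\boldsymbol M\times\frac{\partial H}{\partial\boldsymbol M}+\boldsymbol\gamma\times\frac{\partial H}{\partial\boldsymbol\gamma},\quad \dot{\boldsymbol\gamma}=\boldsymbol\gamma\times\frac{\partial H}{\partial\boldsymbol M},\quad H=\tfrac12(\boldsymbol M,\mathbf A\boldsymbol M)-\mu(\boldsymbol r,\boldsymbol\gamma),\quad \boldsymbol\gamma^2=1,$$ where $\boldsymbol M=(M_1,M_2,M_3)$ is the angular momentum and $\boldsymbol\gamma$ the unit vector of the vertical in the principal body axes, $\mathbf A=\operatorname{diag}(a_1,a_2,a_3)$ is the inverse inertia tensor ($a_1<a_2<a_3$), $\boldsymbol r=(r_1,r_2,r_3)$ is the radius vector of the center of mass, and $\mu$ is a constant. The Hess case is given by the conditions $$r_1\sqrt{a_3-a_2}\pm r_3\sqrt{a_2-a_1}=0,\qquad r_2=0$$ (the center of mass lies on the perpendicular to a circular section of the gyration ellipsoid $(\boldsymbol M,\mathbf A\boldsymbol M)=\mathrm{const}$), and consists of the particular solutions lying on the invariant manifold (Hess relation) $r_1M_1+r_3M_3=0$. *)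

theory Defs
  imports "HOL-Analysis.Analysis"
begin

section \<open>Isomorphism of dynamical systems on subsets of Euclidean space\<close>

text \<open>To be used on open sets only: the derivatives are full derivatives in the ambient space.\<close>

primrec Ck_on :: "nat \<Rightarrow> ('a::euclidean_space \<Rightarrow> 'b::euclidean_space) \<Rightarrow> 'a set \<Rightarrow> bool" where
  "Ck_on 0 f U \<longleftrightarrow> continuous_on U f"
| "Ck_on (Suc k) f U \<longleftrightarrow>
     (\<forall>x\<in>U. f differentiable (at x)) \<and>
     (\<forall>v. Ck_on k (\<lambda>x. frechet_derivative f (at x) v) U)"

definition smooth_near :: "'a::euclidean_space set \<Rightarrow> ('a \<Rightarrow> 'b::euclidean_space) \<Rightarrow> bool" where
  "smooth_near S f \<longleftrightarrow> (\<exists>U. open U \<and> S \<subseteq> U \<and> (\<forall>k. Ck_on k f U))"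

text \<open>
  A system is a phase space \<open>S\<close> (an embedded submanifold) with a vector field \<open>X\<close> given on the
  ambient space and tangent to \<open>S\<close> along \<open>S\<close>. Two systems are isomorphic if a diffeomorphism of
  the phase spaces carries one vector field to the other (time is not rescaled). Smooth maps
  between the phase spaces are represented by smooth extensions to a neighbourhood; by
  tangency the last condition does not depend on the extension.
\<close>

definition isomorphic_systems ::
  "'a::euclidean_space set \<Rightarrow> ('a \<Rightarrow> 'a) \<Rightarrow> 'b::euclidean_space set \<Rightarrow> ('b \<Rightarrow> 'b) \<Rightarrow> bool" where
  "isomorphic_systems S X T Y \<longleftrightarrow>
     (\<exists>\<Phi> \<Psi>. smooth_near S \<Phi> \<and> smooth_near T \<Psi> \<and>
        (\<forall>x\<in>S. \<Phi> x \<in> T \<and> \<Psi> (\<Phi> x) = x) \<and>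
        (\<forall>y\<in>T. \<Psi> y \<in> S \<and> \<Phi> (\<Psi> y) = y) \<and>
        (\<forall>x\<in>S. frechet_derivative \<Phi> (at x) (X x) = Y (\<Phi> x)))"


section \<open>The Suslov problem\<close>

definition inertia_tensor :: "real^3^3 \<Rightarrow> bool" where
  "inertia_tensor I \<longleftrightarrow> transpose I = I \<and> (\<forall>v. v \<noteq> 0 \<longrightarrow> 0 < v \<bullet> (I *v v))"

definition principal_moments :: "real^3^3 \<Rightarrow> real set" where
  "principal_moments I = {l. \<exists>v. v \<noteq> 0 \<and> I *v v = l *\<^sub>R v}"

definition suslov_phase_space :: "((real^3) \<times> (real^3)) set" where
  "suslov_phase_space = {(\<omega>, \<gamma>). \<omega>$3 = 0 \<and> norm \<gamma> = 1}"

text \<open>The equations of motion, solved for the derivatives of \<open>(\<omega>, \<gamma>)\<close>; here \<open>b\<close> is minus the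
  weight times the radius vector of the center of mass.\<close>

definition suslov_field :: "real^3^3 \<Rightarrow> real^3 \<Rightarrow> (real^3) \<times> (real^3) \<Rightarrow> (real^3) \<times> (real^3)" where
  "suslov_field I b = (\<lambda>(\<omega>, \<gamma>).
     (vector
        [(- \<omega>$2 * (I$1$3 * \<omega>$1 + I$2$3 * \<omega>$2) + b$3 * \<gamma>$2 - b$2 * \<gamma>$3) / I$1$1,
         (\<omega>$1 * (I$1$3 * \<omega>$1 + I$2$3 * \<omega>$2) + b$1 * \<gamma>$3 - b$3 * \<gamma>$1) / I$2$2,
         0],
      vector
        [- \<gamma>$3 * \<omega>$2,
         \<gamma>$3 * \<omega>$1,
         \<gamma>$1 * \<omega>$2 - \<gamma>$2 * \<omega>$1]))"

definition suslov_hess_case :: "real^3^3 \<Rightarrow> real^3 \<Rightarrow> bool" where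
  "suslov_hess_case I b \<longleftrightarrow>
     inertia_tensor I \<and> I$1$2 = 0 \<and> card (principal_moments I) = 3 \<and>
     I$1$3 = 0 \<and> I$1$1 * I$2$2 = (I$2$2)\<^sup>2 + (I$2$3)\<^sup>2 \<and>
     b$1 = 0 \<and> I$2$2 * b$2 + I$2$3 * b$3 = 0"


section \<open>The Euler--Poisson equations\<close>

definition gradient :: "(real^3 \<Rightarrow> real) \<Rightarrow> real^3 \<Rightarrow> real^3" where
  "gradient f x = (THE D. GDERIV f x :> D)"

definition diag :: "real^3 \<Rightarrow> real^3^3" where
  "diag a = (\<chi> i j. if i = j then a$i else 0)"

definition euler_poisson_H :: "real^3 \<Rightarrow> real^3 \<Rightarrow> real \<Rightarrow> real^3 \<Rightarrow> real^3 \<Rightarrow> real" where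
  "euler_poisson_H a r \<mu> M \<gamma> = 1/2 * (M \<bullet> (diag a *v M)) - \<mu> * (r \<bullet> \<gamma>)"

definition euler_poisson_field ::
  "real^3 \<Rightarrow> real^3 \<Rightarrow> real \<Rightarrow> (real^3) \<times> (real^3) \<Rightarrow> (real^3) \<times> (real^3)" where
  "euler_poisson_field a r \<mu> = (\<lambda>(M, \<gamma>).
     let H_M = gradient (\<lambda>M'. euler_poisson_H a r \<mu> M' \<gamma>) M;
         H_\<gamma> = gradient (\<lambda>\<gamma>'. euler_poisson_H a r \<mu> M \<gamma>') \<gamma>
     in (cross3 M H_M + cross3 \<gamma> H_\<gamma>, cross3 \<gamma> H_M))"

text \<open>\<open>r \<noteq> 0\<close> is implicit in the notion: for \<open>r = 0\<close> the Hess relation below is vacuous.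
  \<open>0 < a$1\<close> expresses that \<open>diag a\<close> is the inverse of an inertia tensor.\<close>

definition euler_poisson_hess_case :: "real^3 \<Rightarrow> real^3 \<Rightarrow> bool" where
  "euler_poisson_hess_case a r \<longleftrightarrow>
     0 < a$1 \<and> a$1 < a$2 \<and> a$2 < a$3 \<and> r \<noteq> 0 \<and>
     (r$1 * sqrt (a$3 - a$2) + r$3 * sqrt (a$2 - a$1) = 0 \<or>
      r$1 * sqrt (a$3 - a$2) - r$3 * sqrt (a$2 - a$1) = 0) \<and>
     r$2 = 0"

definition hess_relation :: "real^3 \<Rightarrow> ((real^3) \<times> (real^3)) set" where
  "hess_relation r = {(M, \<gamma>). r$1 * M$1 + r$3 * M$3 = 0 \<and> norm \<gamma> = 1}"

end

theory Submission
  imports Defs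
begin

text \<open>
  On the Suslov side, let \<open>M = I \<omega>\<close>; in the Hess case it is orthogonal to \<open>b\<close>. In a right-handed
  orthonormal frame \<open>(u\<^sub>1, u\<^sub>2, n)\<close> with \<open>n\<close> parallel to \<open>b\<close> the angular velocity is
  \<open>\<omega> = (M\<^sub>1 / p, M\<^sub>2 / p, c M\<^sub>2)\<close> with \<open>p = I\<^sub>1\<^sub>1\<close> and a constant \<open>c\<close>. On the Euler--Poisson side, let
  \<open>n\<close> be parallel to \<open>r\<close>; by the Hess condition the inverse inertia tensor restricts to the
  multiple \<open>a\<^sub>2\<close> of the identity on the plane orthogonal to \<open>n\<close>, so that on the Hess relation the
  angular velocity again has the form \<open>(a\<^sub>2 M\<^sub>1, a\<^sub>2 M\<^sub>2, c M\<^sub>2)\<close>. Hence a linear map (rotate and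
  pass from \<open>\<omega>\<close> to \<open>M\<close>) identifies the two systems as soon as \<open>p\<close>, \<open>c\<close> and the torques match. The
  remaining entries (\<open>(n, A n)\<close> of the inverse inertia tensor \<open>A\<close>, resp. \<open>I\<^sub>3\<^sub>3\<close>) do not enter the
  equations and are used to satisfy positivity and distinctness of the principal moments.
\<close>

section \<open>Smoothness of linear maps and linear isomorphisms of systems\<close>

lemma Ck_on_const: "Ck_on k (\<lambda>x. c) U"
  by (induction k arbitrary: c) auto

lemma Ck_on_bounded_linear:
  assumes "bounded_linear f"
  shows "Ck_on k f U"
proof (cases k)
  case 0
  then show ?thesis
    using assms by (simp add: linear_continuous_on)
next
  case (Suc j)
  have "frechet_derivative f (at x) = f" for x
    using assms by (metis bounded_linear_imp_has_derivative frechet_derivative_at)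
  then show ?thesis
    using assms Suc by (auto simp: Ck_on_const bounded_linear_imp_differentiable)
qed

text \<open>A linear map is its own derivative everywhere, so only algebraic conditions
  remain.\<close>

lemma isomorphic_systems_linear:
  assumes \<Phi>: "linear \<Phi>" and \<Psi>: "linear \<Psi>"
    and "\<And>x. x \<in> S \<Longrightarrow> \<Phi> x \<in> T \<and> \<Psi> (\<Phi> x) = x"
    and "\<And>y. y \<in> T \<Longrightarrow> \<Psi> y \<in> S \<and> \<Phi> (\<Psi> y) = y"
    and "\<And>x. x \<in> S \<Longrightarrow> \<Phi> (X x) = Y (\<Phi> x)"
  shows "isomorphic_systems S X T Y"
proof -
  have "bounded_linear \<Phi>" "bounded_linear \<Psi>"
    using \<Phi> \<Psi> linear_conv_bounded_linear by blast+
  moreover from this have "frechet_derivative \<Phi> (at x) = \<Phi>" for x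
    by (metis bounded_linear_imp_has_derivative frechet_derivative_at)
  ultimately show ?thesis
    using assms unfolding isomorphic_systems_def smooth_near_def
    by (intro exI[of _ \<Phi>] exI[of _ \<Psi>]) (auto intro!: exI[of _ UNIV] Ck_on_bounded_linear)
qed

section \<open>The Euler--Poisson field in explicit form\<close>

lemma gradient_eq:
  assumes "GDERIV f x :> D"
  shows "gradient f x = D"
  unfolding gradient_def
proof (rule the_equality[where P = "\<lambda>D. GDERIV f x :> D"])
  show "GDERIV f x :> D" by fact
next
  fix D' assume "GDERIV f x :> D'"
  with assms have "(\<lambda>h. h \<bullet> D') = (\<lambda>h. h \<bullet> D)"
    unfolding gderiv_def by (rule has_derivative_unique[rotated])
  then show "D' = D"
    by (metis vector_eq_ldot)
qed

lemma diag_mult: "diag a *v v = vector [a$1 * v$1, a$2 * v$2, a$3 * v$3]"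
  by (simp add: vec_eq_iff forall_3 diag_def matrix_vector_mult_def sum_3)

lemma gradient_euler_poisson_M:
  "gradient (\<lambda>M'. euler_poisson_H a r \<mu> M' \<gamma>) M = diag a *v M"
proof (rule gradient_eq)
  have "((\<lambda>v. diag a *v v) has_derivative (\<lambda>v. diag a *v v)) (at M)"
    by (simp add: bounded_linear_imp_has_derivative)
  then have "((\<lambda>M'. euler_poisson_H a r \<mu> M' \<gamma>) has_derivative
      (\<lambda>h. 1/2 * (M \<bullet> (diag a *v h) + h \<bullet> (diag a *v M)))) (at M)"
    unfolding euler_poisson_H_def by (auto intro!: derivative_eq_intros)
  \<comment> \<open>The two terms agree because \<open>diag a\<close> is symmetric.\<close>
  moreover have "(\<lambda>h. 1/2 * (M \<bullet> (diag a *v h) + h \<bullet> (diag a *v M))) = (\<lambda>h. h \<bullet> (diag a *v M))"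
    by (rule ext) (simp add: diag_mult inner_vec_def sum_3 algebra_simps)
  ultimately show "GDERIV (\<lambda>M'. euler_poisson_H a r \<mu> M' \<gamma>) M :> diag a *v M"
    by (simp add: gderiv_def)
qed

lemma gradient_euler_poisson_gamma:
  "gradient (\<lambda>\<gamma>'. euler_poisson_H a r \<mu> M \<gamma>') \<gamma> = - \<mu> *\<^sub>R r"
proof (rule gradient_eq)
  show "GDERIV (\<lambda>\<gamma>'. euler_poisson_H a r \<mu> M \<gamma>') \<gamma> :> - \<mu> *\<^sub>R r"
    unfolding euler_poisson_H_def gderiv_def
    by (auto intro!: derivative_eq_intros simp: inner_commute)
qed

lemma euler_poisson_field_eq:
  "euler_poisson_field a r \<mu> (M, \<gamma>) =
     (cross3 M (diag a *v M) - \<mu> *\<^sub>R cross3 \<gamma> r, cross3 \<gamma> (diag a *v M))"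
  by (simp add: euler_poisson_field_def Let_def gradient_euler_poisson_M gradient_euler_poisson_gamma
      cross_mult_right)

section \<open>The linear isomorphism for matching parameters\<close>

text \<open>
  The frame is \<open>u\<^sub>1 = (0, 1, 0)\<close>, \<open>u\<^sub>2 = (-z, 0, x)\<close>, \<open>n = (x, 0, z)\<close> for the Euler--Poisson equations
  and \<open>(1, 0, 0)\<close>, \<open>(0, e, f)\<close>, \<open>(0, -f, e)\<close> for the Suslov problem.
\<close>

lemma suslov_euler_poisson_isomorphic:
  fixes I :: "real^3^3" and a b r :: "real^3"
  assumes xz: "x\<^sup>2 + z\<^sup>2 = 1" and ef: "e\<^sup>2 + f\<^sup>2 = 1" and p: "p \<noteq> 0" and e: "e \<noteq> 0" and k: "k \<noteq> 0"
    and I: "I$1$1 = p" "I$2$2 = p * e\<^sup>2" "I$1$3 = 0" "I$2$3 = p * e * f"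
    and b: "b = vector [0, - \<beta> * f, \<beta> * e]"
    and r: "r = vector [k * x, 0, k * z]"
    and a2: "a$2 = 1 / p"
    and plane: "z\<^sup>2 * a$1 + x\<^sup>2 * a$3 = 1 / p"
    and coupling: "x * z * (a$3 - a$1) = - f / (p * e)"
    and torque: "\<mu> * k = - \<beta>"
  shows "isomorphic_systems suslov_phase_space (suslov_field I b)
           (hess_relation r) (euler_poisson_field a r \<mu>)"
proof -
  \<comment> \<open>For \<open>\<omega>$3 = 0\<close> the Suslov vector \<open>I *v \<omega>\<close>
    has frame components \<open>p * \<omega>$1\<close>, \<open>p * e * \<omega>$2\<close>,
    \<open>0\<close>; they and those of \<open>\<gamma>\<close> are transplanted to the other
    frame.\<close>
  define \<Phi> :: "(real^3) \<times> (real^3) \<Rightarrow> (real^3) \<times> (real^3)" where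
    "\<Phi> = (\<lambda>(\<omega>, \<gamma>).
       (vector [- z * (p * e * \<omega>$2), p * \<omega>$1, x * (p * e * \<omega>$2)],
        vector [- z * (e * \<gamma>$2 + f * \<gamma>$3) + x * (e * \<gamma>$3 - f * \<gamma>$2), \<gamma>$1,
                x * (e * \<gamma>$2 + f * \<gamma>$3) + z * (e * \<gamma>$3 - f * \<gamma>$2)]))"
  \<comment> \<open>\<open>\<Psi>\<close> ignores the component \<open>x M\<^sub>1 + z M\<^sub>3\<close>, which vanishes on the Hess relation.\<close>
  define \<Psi> :: "(real^3) \<times> (real^3) \<Rightarrow> (real^3) \<times> (real^3)" where
    "\<Psi> = (\<lambda>(M, \<gamma>).
       (vector [M$2 / p, (x * M$3 - z * M$1) / (p * e), 0],
        vector [\<gamma>$2, e * (x * \<gamma>$3 - z * \<gamma>$1) - f * (x * \<gamma>$1 + z * \<gamma>$3),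
                f * (x * \<gamma>$3 - z * \<gamma>$1) + e * (x * \<gamma>$1 + z * \<gamma>$3)]))"
  have xx: "x * x = 1 - z * z" and ee: "e * e = 1 - f * f"
    using xz ef by (simp_all add: power2_eq_square algebra_simps)
  \<comment> \<open>Variants of \<open>xx\<close> and \<open>ee\<close> that also match inside
    longer, right-associated products.\<close>
  have xx': "x * (x * t) = t - z * (z * t)" and ee': "e * (e * t) = t - f * (f * t)" for t
    by (simp_all add: xx ee left_diff_distrib flip: mult.assoc)
  \<comment> \<open>By \<open>plane\<close> and \<open>coupling\<close>, \<open>diag a\<close> sends
    \<open>p e t u\<^sub>2\<close> to \<open>t (e u\<^sub>2 - f n)\<close>, which in the Suslov
    frame is the angular velocity \<open>(0, t, 0)\<close>. \<open>\<Omega>1\<close> and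
    \<open>\<Omega>3\<close> are the outer components of this.\<close>
  have \<Omega>1: "a$1 * (- z * (p * e * t)) = - z * (e * t) + x * (- f * t)" for t
  proof -
    have "a$1 * z = z * (z\<^sup>2 * a$1 + x\<^sup>2 * a$3) - x * (x * z * (a$3 - a$1))"
      using xz by algebra
    then have "a$1 * z * (p * e) = z * e + x * f"
      unfolding plane coupling using p e by (simp add: field_simps)
    then show ?thesis by algebra
  qed
  have \<Omega>3: "a$3 * (x * (p * e * t)) = x * (e * t) + z * (- f * t)" for t
  proof -
    have "a$3 * x = x * (z\<^sup>2 * a$1 + x\<^sup>2 * a$3) + z * (x * z * (a$3 - a$1))"
      using xz by algebra
    then have "a$3 * x * (p * e) = x * e - z * f"
      unfolding plane coupling using p e by (simp add: field_simps)
    then show ?thesis by algebra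
  qed
  have \<Omega>2: "a$2 * (p * t) = t" for t
    using p by (simp add: a2)
  show ?thesis
  proof (rule isomorphic_systems_linear[of \<Phi> \<Psi>])
    show "linear \<Phi>"
      by (rule linearI) (auto simp: \<Phi>_def vec_eq_iff forall_3 algebra_simps)
    show "linear \<Psi>"
      by (rule linearI) (auto simp: \<Psi>_def vec_eq_iff forall_3 algebra_simps add_divide_distrib
          diff_divide_distrib)
  next
    fix v assume v: "v \<in> suslov_phase_space"
    obtain \<omega> \<gamma> where [simp]: "v = (\<omega>, \<gamma>)" by fastforce
    have \<omega>3: "\<omega>$3 = 0" and \<gamma>: "\<gamma>$1 * \<gamma>$1 + \<gamma>$2 * \<gamma>$2 + \<gamma>$3 * \<gamma>$3 = 1"
      using v by (simp_all add: suslov_phase_space_def norm_eq_1 inner_vec_def sum_3)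
    have "(- z * (e * \<gamma>$2 + f * \<gamma>$3) + x * (e * \<gamma>$3 - f * \<gamma>$2))\<^sup>2 + (\<gamma>$1)\<^sup>2 +
      (x * (e * \<gamma>$2 + f * \<gamma>$3) + z * (e * \<gamma>$3 - f * \<gamma>$2))\<^sup>2 = 1"
      using \<gamma> xz ef by algebra
    then have "\<Phi> v \<in> hess_relation r"
      by (simp add: \<Phi>_def hess_relation_def norm_eq_1 inner_vec_def sum_3 r power2_eq_square)
    moreover have "\<Psi> (\<Phi> v) = v"
      using p e \<omega>3
      by (simp add: \<Phi>_def \<Psi>_def vec_eq_iff forall_3 field_simps xx xx' ee ee')
    ultimately show "\<Phi> v \<in> hess_relation r \<and> \<Psi> (\<Phi> v) = v" by simp
    define A B where "A = (- \<omega>$2 * (I$1$3 * \<omega>$1 + I$2$3 * \<omega>$2) + b$3 * \<gamma>$2 - b$2 * \<gamma>$3) / I$1$1"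
      and "B = (\<omega>$1 * (I$1$3 * \<omega>$1 + I$2$3 * \<omega>$2) + b$1 * \<gamma>$3 - b$3 * \<gamma>$1) / I$2$2"
    \<comment> \<open>Clearing denominators leaves polynomial identities for
      \<open>algebra\<close>.\<close>
    have A: "p * A = - p * e * f * (\<omega>$2)\<^sup>2 + \<beta> * (e * \<gamma>$2 + f * \<gamma>$3)"
      using p by (simp add: A_def I b power2_eq_square field_simps)
    have B: "p * e * B = p * f * \<omega>$1 * \<omega>$2 - \<beta> * \<gamma>$1"
      using p e by (simp add: B_def I b power2_eq_square field_simps)
    have X: "suslov_field I b v =
        (vector [A, B, 0], vector [- \<gamma>$3 * \<omega>$2, \<gamma>$3 * \<omega>$1, \<gamma>$1 * \<omega>$2 - \<gamma>$2 * \<omega>$1])"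
      by (simp add: suslov_field_def A_def B_def)
    have \<Omega>: "diag a *v fst (\<Phi> v) =
        vector [- z * (e * \<omega>$2) + x * (- f * \<omega>$2), \<omega>$1, x * (e * \<omega>$2) + z * (- f * \<omega>$2)]"
      by (simp only: diag_mult \<Phi>_def \<open>v = _\<close> prod.case fst_conv vector_3 \<Omega>1 \<Omega>2 \<Omega>3)
    have "fst (\<Phi> (suslov_field I b v)) =
        cross3 (fst (\<Phi> v)) (diag a *v fst (\<Phi> v)) - \<mu> *\<^sub>R cross3 (snd (\<Phi> v)) r"
      unfolding \<Omega> X
      apply (simp only: \<Phi>_def \<open>v = _\<close> prod.case fst_conv snd_conv vec_eq_iff forall_3 cross3_def r
          vector_3 vector_minus_component vector_scaleR_component real_scaleR_def)
      apply (intro conjI)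
      subgoal using B torque by algebra
      subgoal using A torque xz by algebra
      subgoal using B torque by algebra
      done
    moreover have "snd (\<Phi> (suslov_field I b v)) = cross3 (snd (\<Phi> v)) (diag a *v fst (\<Phi> v))"
      unfolding \<Omega> X
      apply (simp only: \<Phi>_def \<open>v = _\<close> prod.case fst_conv snd_conv vec_eq_iff forall_3 cross3_def
          vector_3)
      apply (intro conjI)
      subgoal by algebra
      subgoal using xz ef by algebra
      subgoal by algebra
      done
    ultimately show "\<Phi> (suslov_field I b v) = euler_poisson_field a r \<mu> (\<Phi> v)"
      by (metis euler_poisson_field_eq prod.collapse)
  next
    fix v assume v: "v \<in> hess_relation r"
    obtain M \<gamma> where [simp]: "v = (M, \<gamma>)" by fastforce
    have "k * (x * M$1 + z * M$3) = 0" and \<gamma>: "\<gamma>$1 * \<gamma>$1 + \<gamma>$2 * \<gamma>$2 + \<gamma>$3 * \<gamma>$3 = 1"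
      using v by (simp_all add: hess_relation_def norm_eq_1 inner_vec_def sum_3 r algebra_simps)
    then have M: "x * M$1 + z * M$3 = 0"
      using k by simp
    have "(\<gamma>$2)\<^sup>2 + (e * (x * \<gamma>$3 - z * \<gamma>$1) - f * (x * \<gamma>$1 + z * \<gamma>$3))\<^sup>2 +
      (f * (x * \<gamma>$3 - z * \<gamma>$1) + e * (x * \<gamma>$1 + z * \<gamma>$3))\<^sup>2 = 1"
      using \<gamma> xz ef by algebra
    then have "\<Psi> v \<in> suslov_phase_space"
      by (simp add: \<Psi>_def suslov_phase_space_def norm_eq_1 inner_vec_def sum_3 power2_eq_square add.assoc)
    \<comment> \<open>With no component along \<open>n\<close>, the pair \<open>(M$1, M$3)\<close>
      is recovered from its projection to \<open>u\<^sub>2\<close>.\<close>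
    moreover have "- z * (x * M$3 - z * M$1) = M$1" "x * (x * M$3 - z * M$1) = M$3"
      using M xz by algebra+
    then have "\<Phi> (\<Psi> v) = v"
      using p e
      by (simp add: \<Phi>_def \<Psi>_def vec_eq_iff forall_3) (simp add: algebra_simps xx xx' ee ee')
    ultimately show "\<Psi> v \<in> suslov_phase_space \<and> \<Phi> (\<Psi> v) = v" by simp
  qed
qed

text \<open>Squaring absorbs both signs of the Hess condition into one polynomial equation.\<close>

lemma sqrt_relation_iff:
  fixes A B u v :: real
  assumes "0 \<le> A" "0 \<le> B"
  shows "u * sqrt A + v * sqrt B = 0 \<or> u * sqrt A - v * sqrt B = 0 \<longleftrightarrow> u\<^sup>2 * A = v\<^sup>2 * B"
proof -
  have "u\<^sup>2 * A = v\<^sup>2 * B \<longleftrightarrow> (u * sqrt A)\<^sup>2 = (v * sqrt B)\<^sup>2"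
    using assms by (simp add: power_mult_distrib)
  then show ?thesis
    unfolding power2_eq_iff by (auto simp: add_eq_0_iff)
qed

section \<open>Inertia tensors in the Suslov Hess case\<close>

lemma inertia_tensor_diagonal_pos:
  fixes I :: "real^3^3"
  assumes "inertia_tensor I"
  shows "0 < I$i$i"
proof -
  have "(axis i 1 :: real^3) \<noteq> 0"
    by simp
  then have "0 < (axis i 1 :: real^3) \<bullet> (I *v axis i 1)"
    using assms by (simp add: inertia_tensor_def)
  then show ?thesis
    by (simp add: matrix_vector_mul_component inner_axis' inner_axis)
qed

lemma inertia_tensor_symmetric: "inertia_tensor I \<Longrightarrow> I$i$j = I$j$i"
  by (simp add: inertia_tensor_def transpose_def vec_eq_iff)

text \<open>Otherwise the tensor is diagonal with \<open>I$1$1 = I$2$2\<close>, leaving at most two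
  principal moments. This gives the strict inequality \<open>a$2 < a$3\<close> later.\<close>

lemma suslov_hess_case_I23_nonzero:
  assumes "suslov_hess_case I b"
  shows "I$2$3 \<noteq> 0"
proof
  assume I23: "I$2$3 = 0"
  have t: "inertia_tensor I" and I: "I$1$2 = 0" "I$1$3 = 0" "I$1$1 * I$2$2 = (I$2$2)\<^sup>2"
    and card: "card (principal_moments I) = 3"
    using assms I23 by (simp_all add: suslov_hess_case_def)
  then have "I$1$1 = I$2$2"
    using inertia_tensor_diagonal_pos[OF t, of 2] by (simp add: power2_eq_square)
  then have "principal_moments I \<subseteq> {I$1$1, I$3$3}"
    using I I23 inertia_tensor_symmetric[OF t, of 2 1] inertia_tensor_symmetric[OF t, of 3 1]
      inertia_tensor_symmetric[OF t, of 3 2]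
    by (auto simp: principal_moments_def vec_eq_iff forall_3 matrix_vector_mult_def sum_3)
  then have "card (principal_moments I) \<le> card {I$1$1, I$3$3}"
    by (intro card_mono) auto
  also have "\<dots> \<le> 2"
    by (simp add: card_insert_if)
  finally show False using card by simp
qed

text \<open>
  The value of \<open>I\<^sub>3\<^sub>3\<close> makes the principal moments \<open>p\<close>, \<open>q / 2\<close> and \<open>2 p - q\<close>.
\<close>

lemma suslov_hess_tensor_exists:
  fixes p q s :: real
  assumes q: "0 < q" and s: "s \<noteq> 0" and pq: "p * q = q\<^sup>2 + s\<^sup>2"
  obtains I :: "real^3^3" where "inertia_tensor I" "card (principal_moments I) = 3"
    "I$1$1 = p" "I$2$2 = q" "I$1$2 = 0" "I$1$3 = 0" "I$2$3 = s"
proof -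
  define d where "d = 2 * p - 3 * q / 2"
  define I :: "real^3^3" where
    "I = vector [vector [p, 0, 0], vector [0, q, s], vector [0, s, d]]"
  have "q * (p - q) > 0"
    using s pq by (simp add: algebra_simps power2_eq_square flip: power2_eq_square)
  then have less: "q < p"
    using q by (simp add: zero_less_mult_iff)
  have Iv: "I *v v = vector [p * v$1, q * v$2 + s * v$3, s * v$2 + d * v$3]" for v
    by (simp add: I_def vec_eq_iff forall_3 matrix_vector_mult_def sum_3)
  have tensor: "inertia_tensor I"
    unfolding inertia_tensor_def
  proof (intro conjI allI impI)
    show "transpose I = I"
      by (simp add: I_def transpose_def vec_eq_iff forall_3)
  next
    fix v :: "real^3" assume "v \<noteq> 0"
    \<comment> \<open>Completing the square, with
      \<open>q * d - s\<^sup>2 = q * (p - q / 2)\<close>.\<close>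
    have "q * (v \<bullet> (I *v v)) =
        p * q * (v$1)\<^sup>2 + (q * v$2 + s * v$3)\<^sup>2 + q * (p - q / 2) * (v$3)\<^sup>2"
      using pq by (simp add: Iv inner_vec_def sum_3 d_def power2_eq_square) algebra
    also have "\<dots> > 0"
    proof (cases "v$1 = 0 \<and> v$3 = 0")
      case True
      with \<open>v \<noteq> 0\<close> have "v$2 \<noteq> 0" by (auto simp: vec_eq_iff forall_3)
      with True q show ?thesis by simp
    next
      case False
      then show ?thesis
        using q less
        by (smt (verit, best) mult_nonneg_nonneg mult_pos_pos zero_le_power2 zero_less_power2
            half_gt_zero_iff field_sum_of_halves)
    qed
    finally show "0 < v \<bullet> (I *v v)"
      using q by (simp add: zero_less_mult_iff)
  qed
  have "principal_moments I = {p, q / 2, 2 * p - q}"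
  proof (intro equalityI subsetI)
    fix l assume "l \<in> principal_moments I"
    then obtain v :: "real^3" where v: "v \<noteq> 0" "I *v v = l *\<^sub>R v"
      by (auto simp: principal_moments_def)
    then have 1: "p * v$1 = l * v$1" and 2: "q * v$2 + s * v$3 = l * v$2"
      and 3: "s * v$2 + d * v$3 = l * v$3"
      by (simp_all add: Iv vec_eq_iff forall_3)
    show "l \<in> {p, q / 2, 2 * p - q}"
    proof (cases "v$1 = 0")
      case True
      \<comment> \<open>The characteristic polynomial of the lower 2x2 block, which annihilates
        \<open>v$2\<close> and \<open>v$3\<close>.\<close>
      have det: "(l - q) * (l - d) - s\<^sup>2 = (l - q / 2) * (l - (2 * p - q))"
        using pq by (simp add: d_def power2_eq_square field_simps)
      have "((l - q) * (l - d) - s\<^sup>2) * v$2 = 0" "((l - q) * (l - d) - s\<^sup>2) * v$3 = 0"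
        using 2 3 by algebra+
      moreover have "v$2 \<noteq> 0 \<or> v$3 \<noteq> 0"
        using v True by (auto simp: vec_eq_iff forall_3)
      ultimately show ?thesis
        unfolding det by auto
    qed (use 1 in auto)
  next
    have ev: "l \<in> principal_moments I" if "(l - q) * (l - d) = s\<^sup>2" for l
      unfolding principal_moments_def
    proof (intro CollectI exI conjI)
      show "(vector [0, s, l - q] :: real^3) \<noteq> 0"
        using s by (simp add: vec_eq_iff forall_3)
      show "I *v vector [0, s, l - q] = l *\<^sub>R vector [0, s, l - q]"
        using that by (simp add: Iv vec_eq_iff forall_3 power2_eq_square algebra_simps)
    qed
    have "p \<in> principal_moments I"
      unfolding principal_moments_def
      by (intro CollectI exI[of _ "vector [1, 0, 0]"]) (simp add: Iv vec_eq_iff forall_3)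
    moreover have "q / 2 \<in> principal_moments I" "2 * p - q \<in> principal_moments I"
      using pq by (auto intro!: ev simp: d_def power2_eq_square field_simps)
    ultimately show "l \<in> principal_moments I" if "l \<in> {p, q / 2, 2 * p - q}" for l
      using that by auto
  qed
  \<comment> \<open>Distinct, since \<open>q < p\<close> gives
    \<open>q / 2 < p < 2 * p - q\<close>.\<close>
  then have "card (principal_moments I) = 3"
    using q less by simp
  with tensor show ?thesis
    by (intro that[of I]) (simp_all add: I_def)
qed

section \<open>The two directions of the equivalence\<close>

text \<open>
  With \<open>a\<^sub>2 = 1 / p\<close> and \<open>a\<^sub>1 = a\<^sub>2 / 2\<close>, the largest \<open>a\<^sub>3\<close> is forced by the coupling constant
  \<open>c = - f / (p e)\<close> through \<open>c\<^sup>2 = (a\<^sub>2 - a\<^sub>1) (a\<^sub>3 - a\<^sub>2)\<close>.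
\<close>

lemma suslov_to_euler_poisson:
  assumes "suslov_hess_case I b"
  shows "\<exists>a r \<mu>. euler_poisson_hess_case a r \<and> (\<mu> = 0 \<longleftrightarrow> b = 0) \<and>
    isomorphic_systems suslov_phase_space (suslov_field I b)
      (hess_relation r) (euler_poisson_field a r \<mu>)"
proof -
  have t: "inertia_tensor I" and I13: "I$1$3 = 0" and I11: "I$1$1 * I$2$2 = (I$2$2)\<^sup>2 + (I$2$3)\<^sup>2"
    and b1: "b$1 = 0" and b23: "I$2$2 * b$2 + I$2$3 * b$3 = 0"
    using assms by (simp_all add: suslov_hess_case_def)
  define p where "p = I$1$1"
  have p: "0 < p" and q: "0 < I$2$2"
    using inertia_tensor_diagonal_pos[OF t] by (simp_all add: p_def)
  \<comment> \<open>Chosen so that the second row of \<open>I\<close> is \<open>p * e\<close> times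
    \<open>u\<^sub>2 = (0, e, f)\<close>; the Hess condition on \<open>I\<close> then says that
    \<open>u\<^sub>2\<close> is a unit vector.\<close>
  define e f where "e = sqrt (I$2$2 / p)" and "f = I$2$3 / (p * e)"
  have e: "0 < e" and f: "f \<noteq> 0"
    using p q suslov_hess_case_I23_nonzero[OF assms] by (simp_all add: e_def f_def)
  have ee: "e\<^sup>2 = I$2$2 / p"
    using p q by (simp add: e_def)
  have I22: "I$2$2 = p * e\<^sup>2" and I23: "I$2$3 = p * e * f"
    using p e ee by (simp_all add: f_def)
  have "(p * e)\<^sup>2 * (e\<^sup>2 + f\<^sup>2) = (p * e)\<^sup>2 * 1"
    using I11 unfolding I22 I23 p_def[symmetric] by algebra
  then have ef: "e\<^sup>2 + f\<^sup>2 = 1"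
    using p e by simp
  \<comment> \<open>The Hess condition on \<open>b\<close> is orthogonality to
    \<open>u\<^sub>2\<close>, so \<open>b\<close> is a multiple \<open>\<beta>\<close> of
    \<open>n\<close>.\<close>
  define \<beta> where "\<beta> = b$3 / e"
  have "p * e * (e * b$2 + f * b$3) = 0"
    using b23 unfolding I22 I23 by algebra
  then have "e * b$2 = - f * b$3"
    using p e by simp
  then have b: "b = vector [0, - \<beta> * f, \<beta> * e]"
    using e b1 by (simp add: vec_eq_iff forall_3 \<beta>_def field_simps)
  define k where "k = sqrt (e\<^sup>2 + 4 * f\<^sup>2)"
  have kk: "k\<^sup>2 = e\<^sup>2 + 4 * f\<^sup>2" and k: "0 < k"
    using e by (simp_all add: k_def add_pos_nonneg)
  \<comment> \<open>The Hess condition fixes \<open>r$3 / r$1\<close> up to sign;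
    \<open>coupling\<close> decides the sign.\<close>
  define a r :: "real^3" where "a = vector [1 / (2 * p), 1 / p, (1 + 2 * f\<^sup>2 / e\<^sup>2) / p]"
    and "r = vector [e, 0, - 2 * f]"
  have diffs: "a$3 - a$2 = 2 * f\<^sup>2 / (p * e\<^sup>2)" "a$2 - a$1 = 1 / (2 * p)"
    using p e by (simp_all add: a_def field_simps)
  then have "0 < a$3 - a$2" "0 < a$2 - a$1"
    using p e f by simp_all
  moreover from this have "r$1 * sqrt (a$3 - a$2) + r$3 * sqrt (a$2 - a$1) = 0 \<or>
      r$1 * sqrt (a$3 - a$2) - r$3 * sqrt (a$2 - a$1) = 0"
    using p e by (subst sqrt_relation_iff) (auto simp: diffs r_def power2_eq_square)
  ultimately have "euler_poisson_hess_case a r"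
    using p e by (simp add: euler_poisson_hess_case_def r_def vec_eq_iff forall_3)
      (simp add: a_def)
  moreover have "- \<beta> / k = 0 \<longleftrightarrow> b = 0"
    using k e by (auto simp: b vec_eq_iff forall_3)
  moreover have "isomorphic_systems suslov_phase_space (suslov_field I b)
      (hess_relation r) (euler_poisson_field a r (- \<beta> / k))"
  proof (rule suslov_euler_poisson_isomorphic)
    show "(e / k)\<^sup>2 + (- 2 * f / k)\<^sup>2 = 1"
      using k by (simp add: power_divide power_mult_distrib kk[symmetric] flip: add_divide_distrib)
    show "(- 2 * f / k)\<^sup>2 * a$1 + (e / k)\<^sup>2 * a$3 = 1 / p"
    proof -
      have "(- 2 * f / k)\<^sup>2 * a$1 + (e / k)\<^sup>2 * a$3 = ((e\<^sup>2 + 4 * f\<^sup>2) / k\<^sup>2) / p"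
        using p e k by (simp add: a_def field_simps)
      then show ?thesis using k by (simp add: kk[symmetric])
    qed
    show "(e / k) * (- 2 * f / k) * (a$3 - a$1) = - f / (p * e)"
    proof -
      have "(e / k) * (- 2 * f / k) * (a$3 - a$1) = - f / (p * e) * ((e\<^sup>2 + 4 * f\<^sup>2) / k\<^sup>2)"
        using p e k by (simp add: a_def field_simps power2_eq_square)
      then show ?thesis using k by (simp add: kk[symmetric])
    qed
    show "b = vector [0, - \<beta> * f, \<beta> * e]" by fact
    show "r = vector [k * (e / k), 0, k * (- 2 * f / k)]"
      using k by (simp add: r_def)
  qed (use ef p e k I13 I22 I23 in \<open>simp_all add: p_def a_def\<close>)
  ultimately show ?thesis by blast
qed

text \<open>The data determine \<open>p = 1 / a$2\<close> and the ratio \<open>f / e = - g\<close>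
  via \<open>coupling\<close>; \<open>suslov_hess_tensor_exists\<close> then supplies a suitable
  \<open>I$3$3\<close>.\<close>

lemma euler_poisson_to_suslov:
  assumes "euler_poisson_hess_case a r"
  shows "\<exists>I b. suslov_hess_case I b \<and> (b = 0 \<longleftrightarrow> \<mu> = 0) \<and>
    isomorphic_systems suslov_phase_space (suslov_field I b)
      (hess_relation r) (euler_poisson_field a r \<mu>)"
proof -
  have a: "0 < a$1" "a$1 < a$2" "a$2 < a$3" and "r \<noteq> 0" and r2: "r$2 = 0"
    and "r$1 * sqrt (a$3 - a$2) + r$3 * sqrt (a$2 - a$1) = 0 \<or>
      r$1 * sqrt (a$3 - a$2) - r$3 * sqrt (a$2 - a$1) = 0"
    using assms by (simp_all add: euler_poisson_hess_case_def)
  then have rel: "(r$1)\<^sup>2 * (a$3 - a$2) = (r$3)\<^sup>2 * (a$2 - a$1)"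
    by (subst (asm) sqrt_relation_iff) auto
  \<comment> \<open>Nonvanishing of both entries yields \<open>g \<noteq> 0\<close>, hence a nonzero
    \<open>I$2$3\<close>.\<close>
  have r13: "r$1 \<noteq> 0" "r$3 \<noteq> 0"
    using rel a \<open>r \<noteq> 0\<close> r2 by (auto simp: vec_eq_iff forall_3)
  define k x z where "k = sqrt ((r$1)\<^sup>2 + (r$3)\<^sup>2)" and "x = r$1 / k" and "z = r$3 / k"
  have kk: "k\<^sup>2 = (r$1)\<^sup>2 + (r$3)\<^sup>2" and k: "0 < k"
    using r13 by (simp_all add: k_def add_pos_pos)
  have r: "r = vector [k * x, 0, k * z]"
    using k r2 by (simp add: vec_eq_iff forall_3 x_def z_def)
  have xz: "x\<^sup>2 + z\<^sup>2 = 1"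
    using k by (simp add: x_def z_def power_divide kk[symmetric] flip: add_divide_distrib)
  have "x\<^sup>2 * (a$3 - a$2) = z\<^sup>2 * (a$2 - a$1)"
    using k rel by (simp add: x_def z_def power_divide)
  \<comment> \<open>The unit vector \<open>(-z, 0, x)\<close> lies in the circular section, where
    the quadratic form of \<open>diag a\<close> equals \<open>a$2\<close>.\<close>
  then have plane: "z\<^sup>2 * a$1 + x\<^sup>2 * a$3 = a$2"
    using xz by algebra
  define p g where "p = 1 / a$2" and "g = x * z * (a$3 - a$1) / a$2"
  have p: "0 < p" and g: "g \<noteq> 0"
    using a r13 k by (simp_all add: p_def g_def x_def z_def)
  define e f where "e = 1 / sqrt (1 + g\<^sup>2)" and "f = - g * e"
  have g1: "0 < 1 + g\<^sup>2" by (simp add: add_pos_nonneg)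
  then have e: "0 < e" and f: "f \<noteq> 0" and ee: "e\<^sup>2 = 1 / (1 + g\<^sup>2)"
    using g by (simp_all add: e_def f_def power_divide)
  have ef: "e\<^sup>2 + f\<^sup>2 = 1"
    using g1 by (simp add: f_def power_mult_distrib ee field_simps)
  have "p * (p * e\<^sup>2) = (p * e\<^sup>2)\<^sup>2 + (p * e * f)\<^sup>2"
    using ef by algebra
  then obtain I :: "real^3^3" where I: "inertia_tensor I" "card (principal_moments I) = 3"
    "I$1$1 = p" "I$2$2 = p * e\<^sup>2" "I$1$2 = 0" "I$1$3 = 0" "I$2$3 = p * e * f"
    using suslov_hess_tensor_exists[of "p * e\<^sup>2" "p * e * f" p] p e f by auto
  \<comment> \<open>\<open>\<beta> = - \<mu> * k\<close> is forced by \<open>torque\<close>.\<close>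
  define b :: "real^3" where "b = vector [0, - (- \<mu> * k) * f, (- \<mu> * k) * e]"
  have "suslov_hess_case I b"
    using I \<open>p * (p * e\<^sup>2) = _\<close>
    by (simp add: suslov_hess_case_def b_def power2_eq_square)
  moreover have "b = 0 \<longleftrightarrow> \<mu> = 0"
    using k e by (auto simp: b_def vec_eq_iff forall_3)
  moreover have "isomorphic_systems suslov_phase_space (suslov_field I b)
      (hess_relation r) (euler_poisson_field a r \<mu>)"
  proof (rule suslov_euler_poisson_isomorphic)
    show "x * z * (a$3 - a$1) = - f / (p * e)"
      using a e by (simp add: f_def p_def g_def)
    show "b = vector [0, - (- \<mu> * k) * f, (- \<mu> * k) * e]" by (fact b_def)
    show "\<mu> * k = - (- \<mu> * k)" by simp
  qed (use xz ef p e k I r plane a in \<open>simp_all add: p_def\<close>)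
  ultimately show ?thesis by blast
qed

theorem proposition7:
  "(\<forall>(I :: real^3^3) (b :: real^3). suslov_hess_case I b \<longrightarrow>
      (\<exists>(a :: real^3) (r :: real^3) (\<mu> :: real).
         euler_poisson_hess_case a r \<and> (\<mu> = 0 \<longleftrightarrow> b = 0) \<and>
         isomorphic_systems suslov_phase_space (suslov_field I b)
                            (hess_relation r) (euler_poisson_field a r \<mu>))) \<and>
   (\<forall>(a :: real^3) (r :: real^3) (\<mu> :: real). euler_poisson_hess_case a r \<longrightarrow>
      (\<exists>(I :: real^3^3) (b :: real^3).
         suslov_hess_case I b \<and> (b = 0 \<longleftrightarrow> \<mu> = 0) \<and>
         isomorphic_systems suslov_phase_space (suslov_field I b)
                            (hess_relation r) (euler_poisson_field a r \<mu>)))"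
  using suslov_to_euler_poisson euler_poisson_to_suslov by blast

end
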